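(* Let $\alpha>0$, $\beta>0$, $n\ge1$, and take $A=0$, $B=1$, so that $D_n(t)=\frac{1}{n!}\int_{[t,1]^n}\prod_{1\le i<j\le n}(x_j-x_i)^2\prod_{k=1}^n x_k^{\alpha}(1-x_k)^{\beta}\,dx_k$. Then, as $t\to1^-$, $$\frac{D_n(t)}{D_n(0)}\sim 2^{2n\alpha}\,\frac{F(0,\beta)\,K(0,\beta,n)}{F(\alpha,\beta)\,K(\alpha,\beta,n)}\,(1-t)^{n(n+\beta)},$$ (i.e. the ratio of the two sides tends to $1$), where $$F(\alpha,\beta)=\frac{\Gamma\big(\tfrac{\alpha+\beta+1}{2}\big)\,G^2\big(\tfrac{\alpha+\beta+1}{2}\big)\,G^2\big(1+\tfrac{\alpha+\beta}{2}\big)}{G(\alpha+\beta+1)\,G(\alpha+1)\,G(\beta+1)},$$ $$K(\alpha,\beta,n)=\frac{G(n+1)\,G(n+\alpha+1)\,G(n+\beta+1)\,G(n+\alpha+\beta+1)}{G^2\big(n+\tfrac{\alpha+\beta+1}{2}\big)\,G^2\big(n+1+\tfrac{\alpha+\beta}{2}\big)\,\Gamma\big(n+\tfrac{\alpha+\beta+1}{2}\big)}.$$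
   Context: $\Gamma$ is the Gamma function and $G$ is the Barnes $G$-function, defined by $G(x+1)=(2\pi)^{x/2}e^{-(x(x+1)+\gamma x^2)/2}\prod_{k=1}^{\infty}\big[(1+x/k)^k e^{-x+x^2/(2k)}\big]$, with $\gamma$ the Euler–Mascheroni constant. $D_n(0)=\frac1{n!}\int_{[0,1]^n}\prod_{i<j}(x_j-x_i)^2\prod_k x_k^\alpha(1-x_k)^\beta dx_k$; the quotient $D_n(t)/D_n(0)$ is the probability that the smallest eigenvalue of the $n\times n$ Jacobi unitary ensemble with weight $x^\alpha(1-x)^\beta$ on $[0,1]$ is at least $t$. *)

theory Defs
  imports "HOL-Analysis.Analysis"
begin

definition barnesG :: "real \<Rightarrow> real" where
  "barnesG y = (let x = y - 1 in
     (2 * pi) powr (x / 2) * exp (- (x * (x + 1) + euler_mascheroni * x\<^sup>2) / 2) *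
     (\<Prod>k. (1 + x / real (Suc k)) ^ (Suc k) * exp (- x + x\<^sup>2 / (2 * real (Suc k)))))"

definition Dn :: "real \<Rightarrow> real \<Rightarrow> nat \<Rightarrow> real \<Rightarrow> real" where
  "Dn \<alpha> \<beta> n t = (1 / fact n) *
     (\<integral>x. indicator {x. \<forall>i<n. x i \<in> {t..1}} x *
        ((\<Prod>j<n. \<Prod>i<j. (x j - x i)\<^sup>2) * (\<Prod>k<n. x k powr \<alpha> * (1 - x k) powr \<beta>))
      \<partial>(PiM {..<n} (\<lambda>_. lborel)))"

definition Ffun :: "real \<Rightarrow> real \<Rightarrow> real" where
  "Ffun \<alpha> \<beta> = Gamma ((\<alpha> + \<beta> + 1) / 2) * (barnesG ((\<alpha> + \<beta> + 1) / 2))\<^sup>2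
      * (barnesG (1 + (\<alpha> + \<beta>) / 2))\<^sup>2
      / (barnesG (\<alpha> + \<beta> + 1) * barnesG (\<alpha> + 1) * barnesG (\<beta> + 1))"

definition Kfun :: "real \<Rightarrow> real \<Rightarrow> nat \<Rightarrow> real" where
  "Kfun \<alpha> \<beta> n = barnesG (real n + 1) * barnesG (real n + \<alpha> + 1) * barnesG (real n + \<beta> + 1)
      * barnesG (real n + \<alpha> + \<beta> + 1)
      / ((barnesG (real n + (\<alpha> + \<beta> + 1) / 2))\<^sup>2 * (barnesG (real n + 1 + (\<alpha> + \<beta>) / 2))\<^sup>2
         * Gamma (real n + (\<alpha> + \<beta> + 1) / 2))"

end

theory Submission
  imports Defs "HOL-Real_Asymp.Real_Asymp" "Jordan_Normal_Form.Determinant"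
begin

text \<open>
  The squared Vandermonde product is a product of two determinants of polynomials evaluated at the
  \<open>x k\<close>, so by Andreief's identity \<^term>\<open>Dn \<alpha> \<beta> n t\<close> is a determinant of weighted integrals of
  products \<open>p i * q j\<close>, for any two families of polynomials with coefficient
  matrices of determinant 1.

  At \<open>t = 0\<close>, pairing \<open>x ^ i\<close> with \<open>x ^ j * (1 - x) ^ (n - 1 - j)\<close> gives Beta integrals whose only
  factor depending on both indices is a Pochhammer symbol, again a monic polynomial at equidistant
  nodes; this evaluates \<^term>\<open>Dn \<alpha> \<beta> n 0\<close> as a Gamma product (Selberg). For \<open>\<alpha> = 0\<close>, an affine
  substitution in the moments of \<open>x - 1\<close> shows that \<^term>\<open>Dn 0 \<beta> n t\<close> is exactly
  \<open>(1 - t) powr (n * (n + \<beta>))\<close> times its value at \<open>t = 0\<close>. Since \<open>t powr \<alpha> \<le> x powr \<alpha> \<le> 1\<close> on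
  \<open>[t, 1]\<close>, the quotient \<^term>\<open>Dn \<alpha> \<beta> n t / Dn 0 \<beta> n t\<close> tends to 1.

  It remains to recognise \<^term>\<open>Dn 0 \<beta> n 0 / Dn \<alpha> \<beta> n 0\<close> in the Barnes functions. Comparing
  partial products gives the functional equation \<open>G (y + 1) = \<Gamma> y * G y\<close> up to the limit of
  \<open>n ^ (n + 1 / 2) * e ^ - n / n!\<close>, which is found by comparing \<open>2 * n\<close> with \<open>n\<close> (Stirling).
  The functional equation turns the Barnes functions into Gamma products, and Legendre's
  duplication formula matches those with Selberg's.
\<close>

section \<open>The functional equation of the Barnes function\<close>

definition barnes_factor :: "real \<Rightarrow> nat \<Rightarrow> real" where
  "barnes_factor x k = (1 + x / real (Suc k)) ^ Suc k * exp (- x + x\<^sup>2 / (2 * real (Suc k)))"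

lemma barnesG_conv_prodinf:
  "barnesG (x + 1) = (2 * pi) powr (x / 2) * exp (- (x * (x + 1) + euler_mascheroni * x\<^sup>2) / 2) *
     prodinf (barnes_factor x)"
  by (simp add: barnesG_def barnes_factor_def[abs_def])

lemma barnes_factor_0 [simp]: "barnes_factor 0 = (\<lambda>_. 1)"
  by (simp add: barnes_factor_def[abs_def])

lemma barnes_factor_pos:
  assumes "x > -1"
  shows "barnes_factor x k > 0"
proof -
  have "real (Suc k) + x > 0" using assms by simp
  hence "1 + x / real (Suc k) > 0" by (simp add: field_simps)
  thus ?thesis unfolding barnes_factor_def by (intro mult_pos_pos zero_less_power) auto
qed

lemma ln_barnes_factor:
  fixes x :: real and k :: nat
  assumes "x > -1"
  defines "z \<equiv> x / real (Suc k)"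
  shows "ln (barnes_factor x k) = real (Suc k) * (ln (1 + z) - z + z\<^sup>2 / 2)"
proof -
  have "real (Suc k) + x > 0" using assms by simp
  hence "1 + z > 0" by (simp add: z_def field_simps)
  hence "ln (barnes_factor x k) = real (Suc k) * ln (1 + z) + (- x + x\<^sup>2 / (2 * real (Suc k)))"
    unfolding barnes_factor_def z_def
    by (simp only: ln_mult_pos ln_realpow ln_exp zero_less_power exp_gt_zero)
  also have "- x + x\<^sup>2 / (2 * real (Suc k)) = real (Suc k) * (- z + z\<^sup>2 / 2)"
    by (simp add: z_def power2_eq_square field_simps del: of_nat_Suc)
  finally show ?thesis by (simp add: algebra_simps)
qed

lemma summable_ln_barnes_factor:
  assumes "x > -1" "x \<noteq> 0"
  shows "summable (\<lambda>k. ln (barnes_factor x k))"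
proof (rule summable_comparison_test_bigo)
  have "summable (\<lambda>k. 1 / real k ^ 2)"
    using inverse_power_summable[of 2, where 'a = real] by (simp add: field_simps)
  thus "summable (\<lambda>k. norm (1 / real k ^ 2))" by simp
  define z where "z = (\<lambda>k. x / real (Suc k))"
  have "filterlim z (at 0) sequentially"
    using assms(2) unfolding z_def by real_asymp
  moreover have "(\<lambda>z::real. ln (1 + z) - z + z\<^sup>2 / 2) \<in> O[at 0](\<lambda>z. z ^ 3)" by real_asymp
  ultimately have "(\<lambda>k. ln (1 + z k) - z k + (z k)\<^sup>2 / 2) \<in> O(\<lambda>k. z k ^ 3)"
    by (rule landau_o.big.compose[rotated])
  hence "(\<lambda>k. ln (barnes_factor x k)) \<in> O(\<lambda>k. real (Suc k) * z k ^ 3)"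
    unfolding ln_barnes_factor[OF assms(1)] z_def by (intro landau_o.big.mult landau_o.big_refl)
  also have "(\<lambda>k. real (Suc k) * z k ^ 3) \<in> O(\<lambda>k. 1 / real k ^ 2)"
    using assms(2) unfolding z_def by real_asymp
  finally show "(\<lambda>k. ln (barnes_factor x k)) \<in> O(\<lambda>k. 1 / real k ^ 2)" .
qed

lemma convergent_prod_barnes_factor:
  assumes "x > -1"
  shows "convergent_prod (barnes_factor x)"
proof (cases "x = 0")
  case True
  thus ?thesis by simp
next
  case False
  show ?thesis
    using convergent_prod_exp[OF summable_ln_barnes_factor[OF assms False]]
    by (simp add: barnes_factor_pos[OF assms])
qed

lemma prod_barnes_factor_LIMSEQ:
  assumes "x > -1"
  shows "(\<lambda>N. \<Prod>k<N. barnes_factor x k) \<longlonglongrightarrow> prodinf (barnes_factor x)"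
  using convergent_prod_barnes_factor[OF assms]
  by (intro has_prod_imp_tendsto' convergent_prod_has_prod)

lemma prodinf_barnes_factor_pos:
  assumes "x > -1"
  shows "prodinf (barnes_factor x) > 0"
  by (rule has_prod_pos[OF convergent_prod_has_prod[OF convergent_prod_barnes_factor[OF assms]]])
     (rule barnes_factor_pos[OF assms])

lemma barnesG_pos: "y > 0 \<Longrightarrow> barnesG y > 0"
  using barnesG_conv_prodinf[of "y - 1"] prodinf_barnes_factor_pos[of "y - 1"] by simp

lemma barnesG_1 [simp]: "barnesG 1 = 1"
  by (simp add: barnesG_def)

definition barnes_quotient :: "real \<Rightarrow> nat \<Rightarrow> real" where
  "barnes_quotient x N = (\<Prod>k<N. barnes_factor (x + 1) k) / (\<Prod>k<N. barnes_factor x k)"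

lemma barnes_quotient_LIMSEQ:
  assumes "x > -1"
  shows "barnes_quotient x \<longlonglongrightarrow> prodinf (barnes_factor (x + 1)) / prodinf (barnes_factor x)"
  unfolding barnes_quotient_def using assms prodinf_barnes_factor_pos[OF assms]
  by (intro tendsto_divide prod_barnes_factor_LIMSEQ) auto

lemma barnes_factor_divide:
  fixes x :: real and k :: nat
  assumes "x > -1"
  defines "m \<equiv> real (Suc k)"
  shows "barnes_factor (x + 1) k / barnes_factor x k =
    ((m + 1 + x) / (m + x)) ^ Suc k * exp (- 1 + (x + 1 / 2) / m)"
proof -
  have m_pos: "m > 0" "m + x > 0" using assms by auto
  have "barnes_factor (x + 1) k / barnes_factor x k = ((1 + (x + 1) / m) / (1 + x / m)) ^ Suc k *
      exp ((- (x + 1) + (x + 1)\<^sup>2 / (2 * m)) - (- x + x\<^sup>2 / (2 * m)))"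
    unfolding barnes_factor_def m_def exp_diff power_divide times_divide_times_eq ..
  also have "(1 + (x + 1) / m) / (1 + x / m) = (m + 1 + x) / (m + x)"
    using m_pos by (simp add: divide_simps add_ac)
  also have "(- (x + 1) + (x + 1)\<^sup>2 / (2 * m)) - (- x + x\<^sup>2 / (2 * m)) = - 1 + (x + 1 / 2) / m"
    using m_pos by (simp add: field_simps power2_eq_square)
  finally show ?thesis .
qed

lemma barnes_quotient_eq:
  assumes "x > -1"
  shows "barnes_quotient x N =
    (real N + 1 + x) ^ N / pochhammer (x + 1) N * exp (- real N + (x + 1 / 2) * harm N)"
proof (induction N)
  case 0
  show ?case by (simp add: barnes_quotient_def harm_def)
next
  case (Suc N)
  define m where "m = real (Suc N)"
  have m_pos: "m > 0" "m + x > 0" using assms by (auto simp: m_def)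
  have "barnes_quotient x (Suc N) =
      barnes_quotient x N * (barnes_factor (x + 1) N / barnes_factor x N)"
    by (simp add: barnes_quotient_def)
  also have "\<dots> = ((m + x) ^ N / pochhammer (x + 1) N * exp (- real N + (x + 1 / 2) * harm N)) *
      (((m + 1 + x) / (m + x)) ^ Suc N * exp (- 1 + (x + 1 / 2) / m))"
    unfolding Suc.IH barnes_factor_divide[OF assms] by (simp add: m_def add_ac)
  also have "\<dots> = (m + 1 + x) ^ Suc N / (pochhammer (x + 1) N * (m + x)) *
      exp ((- real N + (x + 1 / 2) * harm N) + (- 1 + (x + 1 / 2) / m))"
    unfolding exp_add[of "- real N + (x + 1 / 2) * harm N"]
    using m_pos by (simp add: power_divide)
  also have "pochhammer (x + 1) N * (m + x) = pochhammer (x + 1) (Suc N)"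
    by (simp add: pochhammer_Suc m_def add_ac)
  also have "(- real N + (x + 1 / 2) * harm N) + (- 1 + (x + 1 / 2) / m) =
      - real (Suc N) + (x + 1 / 2) * harm (Suc N)"
    using m_pos by (simp add: harm_Suc m_def field_simps)
  finally show ?case by (simp add: m_def)
qed

definition stirling_quotient :: "nat \<Rightarrow> real" where
  "stirling_quotient n = sqrt (real n) * real n ^ n * exp (- real n) / fact n"

lemma barnes_quotient_conv_Gamma_series':
  assumes "x > -1" "N > 0"
  shows "barnes_quotient x N =
    Gamma_series' (x + 1) N * exp ((x + 1 / 2) * (harm N - ln (real N))) *
    (1 + (x + 1) / real N) ^ N * stirling_quotient N"
proof -
  have N_pos: "real N > 0" using assms by simp
  have Gamma_series: "Gamma_series' (x + 1) N = fact N * real N powr x / pochhammer (x + 1) N"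
    using assms by (simp add: Gamma_series'_def powr_def fact_reduce[of N] exp_add ring_distribs)
  have exp_harm: "exp ((x + 1 / 2) * (harm N - ln (real N))) =
      exp ((x + 1 / 2) * harm N) / (real N powr x * sqrt (real N))"
    using N_pos
    by (simp add: right_diff_distrib exp_diff powr_half_sqrt[symmetric] powr_def flip: exp_add)
       (simp add: algebra_simps)
  have power: "(1 + (x + 1) / real N) ^ N = (real N + 1 + x) ^ N / real N ^ N"
    using N_pos by (simp add: field_simps flip: power_divide)
  show ?thesis
    unfolding barnes_quotient_eq[OF assms(1)] Gamma_series exp_harm power stirling_quotient_def
      exp_add
    using N_pos by simp
qed

lemma barnes_quotient_asymp:
  assumes "x > -1"
  shows "(\<lambda>N. barnes_quotient x N / stirling_quotient N)
    \<longlonglongrightarrow> Gamma (x + 1) * exp ((x + 1 / 2) * euler_mascheroni) * exp (x + 1)"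
proof (rule Lim_transform_eventually)
  define g where "g = (\<lambda>N. Gamma_series' (x + 1) N * exp ((x + 1 / 2) * (harm N - ln (real N))) *
    (1 + (x + 1) / real N) ^ N)"
  show "g \<longlonglongrightarrow> Gamma (x + 1) * exp ((x + 1 / 2) * euler_mascheroni) * exp (x + 1)"
    unfolding g_def
    by (intro tendsto_intros Gamma_series'_LIMSEQ euler_mascheroni_LIMSEQ
        tendsto_exp_limit_sequentially)
  show "\<forall>\<^sub>F N in sequentially. g N = barnes_quotient x N / stirling_quotient N"
    using eventually_gt_at_top[of 0]
  proof eventually_elim
    case (elim N)
    thus ?case using barnes_quotient_conv_Gamma_series'[OF assms elim]
      by (simp add: stirling_quotient_def g_def)
  qed
qed

lemma stirling_quotient_convergent:
  obtains l where "l > 0" "stirling_quotient \<longlonglongrightarrow> l"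
proof
  define c where "c = exp (euler_mascheroni / 2) * exp (1 :: real)"
  have "barnes_quotient 0 \<longlonglongrightarrow> prodinf (barnes_factor 1)"
    using barnes_quotient_LIMSEQ[of 0] by simp
  moreover have "(\<lambda>N. barnes_quotient 0 N / stirling_quotient N) \<longlonglongrightarrow> c"
    using barnes_quotient_asymp[of 0] by (simp add: c_def)
  ultimately have "(\<lambda>N. barnes_quotient 0 N / (barnes_quotient 0 N / stirling_quotient N))
      \<longlonglongrightarrow> prodinf (barnes_factor 1) / c"
    by (rule tendsto_divide) (simp add: c_def)
  moreover have "barnes_quotient 0 N \<noteq> 0" for N
    unfolding barnes_quotient_def
    by (intro less_imp_neq[symmetric] divide_pos_pos prod_pos) (auto intro: barnes_factor_pos)
  ultimately show "stirling_quotient \<longlonglongrightarrow> prodinf (barnes_factor 1) / c" by simp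
  show "prodinf (barnes_factor 1) / c > 0"
    using prodinf_barnes_factor_pos[of 1] by (simp add: c_def)
qed

lemma stirling_quotient_double:
  assumes "n > 0"
  shows "stirling_quotient (2 * n) = sqrt 2 * Gamma_series' (1 / 2) n * (stirling_quotient n)\<^sup>2"
proof -
  have Gamma_series: "Gamma_series' (1 / 2) n = fact n / (sqrt (real n) * pochhammer (1 / 2) n)"
  proof -
    have "exp (1 / 2 * ln (real n)) = sqrt (real n)"
      using assms by (simp add: powr_half_sqrt[symmetric] powr_def)
    also have "\<dots> = real n / sqrt (real n)" by (simp add: real_div_sqrt)
    finally show ?thesis using assms by (simp add: Gamma_series'_def fact_reduce[of n])
  qed
  have "pochhammer (1 / 2) n > (0 :: real)" by (intro pochhammer_pos) simp
  moreover have "real (2 * n) ^ (2 * n) = 2 ^ (2 * n) * (real n ^ n)\<^sup>2"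
    by (simp add: power_mult_distrib power_mult[symmetric] mult.commute)
  moreover have "exp (- real (2 * n)) = (exp (- real n))\<^sup>2"
    by (simp flip: exp_of_nat_mult)
  ultimately show ?thesis
    using assms unfolding stirling_quotient_def Gamma_series fact_double
    by (simp add: real_sqrt_mult field_simps power2_eq_square)
qed

lemma stirling_quotient_LIMSEQ: "stirling_quotient \<longlonglongrightarrow> 1 / sqrt (2 * pi)"
proof -
  obtain l where l: "l > 0" "stirling_quotient \<longlonglongrightarrow> l"
    by (rule stirling_quotient_convergent)
  have "(\<lambda>n. sqrt 2 * Gamma_series' (1 / 2) n * (stirling_quotient n)\<^sup>2)
      \<longlonglongrightarrow> sqrt 2 * Gamma (1 / 2) * l\<^sup>2"
    by (intro tendsto_intros Gamma_series'_LIMSEQ l)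
  moreover have "\<forall>\<^sub>F n in sequentially.
      sqrt 2 * Gamma_series' (1 / 2) n * (stirling_quotient n)\<^sup>2 = stirling_quotient (2 * n)"
    using eventually_gt_at_top[of 0] by eventually_elim (simp add: stirling_quotient_double)
  ultimately have "(\<lambda>n. stirling_quotient (2 * n)) \<longlonglongrightarrow> sqrt 2 * Gamma (1 / 2) * l\<^sup>2"
    by (rule Lim_transform_eventually)
  moreover have "(\<lambda>n. stirling_quotient (2 * n)) \<longlonglongrightarrow> l"
    using LIMSEQ_subseq_LIMSEQ[OF l(2), of "\<lambda>n. 2 * n"] by (simp add: strict_mono_def o_def)
  ultimately have "sqrt 2 * Gamma (1 / 2) * l\<^sup>2 = l" by (rule LIMSEQ_unique)
  hence "l = 1 / sqrt (2 * pi)"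
    using l(1) by (simp add: Gamma_one_half_real real_sqrt_mult power2_eq_square field_simps)
  thus ?thesis using l(2) by simp
qed

lemma prodinf_barnes_factor_plus1:
  assumes "x > -1"
  shows "prodinf (barnes_factor (x + 1)) = Gamma (x + 1) *
    exp ((x + 1 / 2) * euler_mascheroni) * exp (x + 1) / sqrt (2 * pi) * prodinf (barnes_factor x)"
proof -
  define L where
    "L = Gamma (x + 1) * exp ((x + 1 / 2) * euler_mascheroni) * exp (x + 1) * (1 / sqrt (2 * pi))"
  have "(\<lambda>N. barnes_quotient x N / stirling_quotient N * stirling_quotient N) \<longlonglongrightarrow> L"
    unfolding L_def by (intro tendsto_mult barnes_quotient_asymp stirling_quotient_LIMSEQ assms)
  moreover have "\<forall>\<^sub>F N in sequentially.
      barnes_quotient x N / stirling_quotient N * stirling_quotient N = barnes_quotient x N"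
    using eventually_gt_at_top[of 0] by eventually_elim (simp add: stirling_quotient_def)
  ultimately have "barnes_quotient x \<longlonglongrightarrow> L" by (rule Lim_transform_eventually)
  with barnes_quotient_LIMSEQ[OF assms]
  have "prodinf (barnes_factor (x + 1)) / prodinf (barnes_factor x) = L"
    by (rule LIMSEQ_unique)
  thus ?thesis
    using prodinf_barnes_factor_pos[OF assms] by (simp add: L_def divide_eq_eq)
qed

theorem barnesG_plus1:
  assumes "y > 0"
  shows "barnesG (y + 1) = Gamma y * barnesG y"
proof -
  define x where "x = y - 1"
  have x: "x > -1" "y = x + 1" using assms by (simp_all add: x_def)
  have exp_shift: "exp (- ((x + 1) * (x + 1 + 1) + euler_mascheroni * (x + 1)\<^sup>2) / 2) *
      (exp ((x + 1 / 2) * euler_mascheroni) * exp (x + 1)) =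
      exp (- (x * (x + 1) + euler_mascheroni * x\<^sup>2) / 2 :: real)"
    unfolding exp_add[symmetric]
    by (rule arg_cong[of _ _ exp]) (simp add: field_simps power2_eq_square)
  have powr_shift: "(2 * pi) powr ((x + 1) / 2) * (1 / sqrt (2 * pi)) = (2 * pi) powr (x / 2)"
    by (simp add: add_divide_distrib powr_add powr_half_sqrt)
  have "barnesG (y + 1) = Gamma (x + 1) * ((2 * pi) powr ((x + 1) / 2) * (1 / sqrt (2 * pi))) *
      (exp (- ((x + 1) * (x + 1 + 1) + euler_mascheroni * (x + 1)\<^sup>2) / 2) *
      (exp ((x + 1 / 2) * euler_mascheroni) * exp (x + 1))) * prodinf (barnes_factor x)"
    unfolding x(2) barnesG_conv_prodinf[of "x + 1"] prodinf_barnes_factor_plus1[OF x(1)] by simp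
  also have "\<dots> = Gamma (x + 1) * barnesG (x + 1)"
    unfolding exp_shift powr_shift barnesG_conv_prodinf[of x] by (simp only: mult_ac)
  finally show ?thesis unfolding x(2) .
qed

lemma barnesG_add_of_nat:
  assumes "y > 0"
  shows "barnesG (y + real n) = barnesG y * (\<Prod>j<n. Gamma (y + real j))"
proof (induction n)
  case (Suc n)
  have "barnesG (y + real (Suc n)) = Gamma (y + real n) * barnesG (y + real n)"
    using barnesG_plus1[of "y + real n"] assms by (simp add: add_ac)
  thus ?case using Suc.IH by simp
qed simp

section \<open>Vandermonde determinants\<close>

definition vandermonde :: "nat \<Rightarrow> (nat \<Rightarrow> 'a) \<Rightarrow> 'a :: comm_ring_1" where
  "vandermonde n x = (\<Prod>j<n. \<Prod>i<j. x j - x i)"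

definition eval_mat :: "nat \<Rightarrow> (nat \<Rightarrow> 'a :: comm_ring_1 poly) \<Rightarrow> (nat \<Rightarrow> 'a) \<Rightarrow> 'a mat" where
  "eval_mat n p x = mat n n (\<lambda>(i, j). poly (p j) (x i))"

definition coeff_mat :: "nat \<Rightarrow> (nat \<Rightarrow> 'a :: comm_ring_1 poly) \<Rightarrow> 'a mat" where
  "coeff_mat n p = mat n n (\<lambda>(k, j). coeff (p j) k)"

definition newton_poly :: "(nat \<Rightarrow> 'a :: comm_ring_1) \<Rightarrow> nat \<Rightarrow> 'a poly" where
  "newton_poly x k = (\<Prod>m<k. [:- x m, 1:])"

lemma poly_newton_poly: "poly (newton_poly x k) y = (\<Prod>m<k. y - x m)"
  by (simp add: newton_poly_def poly_prod)

lemma degree_newton_poly: "degree (newton_poly x k) \<le> k"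
  and coeff_newton_poly_self: "coeff (newton_poly x k) k = 1"
proof (induction k)
  case 0
  case 1 show ?case by (simp add: newton_poly_def)
  case 2 show ?case by (simp add: newton_poly_def)
next
  case (Suc k)
  have newton_poly_Suc: "newton_poly x (Suc k) = pCons (- x k) 1 * newton_poly x k"
    by (simp add: newton_poly_def mult.commute)
  case 1
  show ?case unfolding newton_poly_Suc
    by (rule order.trans[OF degree_mult_le]) (use Suc.IH(1) in simp)
  case 2
  show ?case using Suc.IH by (simp add: newton_poly_Suc coeff_eq_0)
qed

lemma eval_mat_eq_mult_coeff_mat:
  assumes "\<And>j. j < n \<Longrightarrow> degree (p j) < n"
  shows "eval_mat n p x = eval_mat n (monom 1) x * coeff_mat n p"
proof (rule eq_matI)
  fix i j assume "i < dim_row (eval_mat n (monom 1) x * coeff_mat n p)"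
    "j < dim_col (eval_mat n (monom 1) x * coeff_mat n p)"
  hence ij: "i < n" "j < n" by (simp_all add: eval_mat_def coeff_mat_def)
  have "poly (p j) (x i) = (\<Sum>k\<le>degree (p j). x i ^ k * coeff (p j) k)"
    by (simp add: poly_altdef mult.commute)
  also have "\<dots> = (\<Sum>k<n. x i ^ k * coeff (p j) k)"
    using assms[OF ij(2)] by (intro sum.mono_neutral_left) (auto simp: coeff_eq_0)
  finally show "eval_mat n p x $$ (i, j) = (eval_mat n (monom 1) x * coeff_mat n p) $$ (i, j)"
    using ij by (simp add: eval_mat_def coeff_mat_def scalar_prod_def poly_monom atLeast0LessThan)
qed (simp_all add: eval_mat_def coeff_mat_def)

lemma det_coeff_mat_upper_unitriangular:
  assumes "\<And>j. j < n \<Longrightarrow> degree (p j) \<le> j" "\<And>j. j < n \<Longrightarrow> coeff (p j) j = 1"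
  shows "det (coeff_mat n p) = 1"
proof -
  have "coeff (p j) k = 0" if "j < k" "j < n" for j k
    using assms(1)[of j] that by (intro coeff_eq_0) simp
  hence "det (coeff_mat n p) = prod_list (diag_mat (coeff_mat n p))"
    by (intro det_upper_triangular[of _ n]) (auto simp: coeff_mat_def upper_triangular_def)
  thus ?thesis by (simp add: prod_list_diag_prod coeff_mat_def assms(2))
qed

lemma det_coeff_mat_lower_unitriangular:
  assumes "\<And>j k. k < j \<Longrightarrow> j < n \<Longrightarrow> coeff (p j) k = 0" "\<And>j. j < n \<Longrightarrow> coeff (p j) j = 1"
  shows "det (coeff_mat n p) = 1"
proof -
  have "det (coeff_mat n p) = prod_list (diag_mat (coeff_mat n p))"
    using assms(1) by (intro det_lower_triangular[of n]) (auto simp: coeff_mat_def)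
  thus ?thesis by (simp add: prod_list_diag_prod coeff_mat_def assms(2))
qed

lemma det_eval_mat_eq_mult_coeff_mat:
  assumes "\<And>j. j < n \<Longrightarrow> degree (p j) < n"
  shows "det (eval_mat n p x) = det (eval_mat n (monom 1) x) * det (coeff_mat n p)"
proof -
  have "eval_mat n p x = eval_mat n (monom 1) x * coeff_mat n p"
    by (rule eval_mat_eq_mult_coeff_mat) (rule assms)
  thus ?thesis
    using det_mult[of "eval_mat n (monom 1) x" n "coeff_mat n p"]
    by (simp add: eval_mat_def coeff_mat_def)
qed

lemma det_coeff_mat_newton_poly: "det (coeff_mat n (newton_poly x)) = 1"
  by (intro det_coeff_mat_upper_unitriangular degree_newton_poly coeff_newton_poly_self)

lemma det_eval_mat_monom: "det (eval_mat n (monom 1) x) = vandermonde n x"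
proof -
  have "det (eval_mat n (monom 1) x) = det (eval_mat n (newton_poly x) x)"
    using det_eval_mat_eq_mult_coeff_mat[of n "newton_poly x" x]
    by (simp add: det_coeff_mat_newton_poly le_less_trans[OF degree_newton_poly])
  also have "\<dots> = prod_list (diag_mat (eval_mat n (newton_poly x) x))"
    by (rule det_lower_triangular[of n])
       (auto simp: eval_mat_def poly_newton_poly intro!: prod_zero)
  also have "\<dots> = vandermonde n x"
    by (simp add: prod_list_diag_prod eval_mat_def poly_newton_poly vandermonde_def
        atLeast0LessThan)
  finally show ?thesis .
qed

theorem det_eval_mat:
  assumes "\<And>j. j < n \<Longrightarrow> degree (p j) < n"
  shows "det (eval_mat n p x) = vandermonde n x * det (coeff_mat n p)"
  using det_eval_mat_eq_mult_coeff_mat[OF assms] by (simp add: det_eval_mat_monom)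

lemma vandermonde_arith_prog:
  "vandermonde n (\<lambda>i. a + of_nat i :: 'a :: {comm_ring_1, ring_char_0}) = (\<Prod>j<n. fact j)"
proof -
  have "(\<Prod>i<j. (a + of_nat j) - (a + of_nat i)) = (fact j :: 'a)" for j
    by (simp add: fact_prod_rev atLeast0LessThan of_nat_diff)
  thus ?thesis by (simp add: vandermonde_def)
qed

lemma det_pochhammer:
  fixes a :: "'a :: {comm_ring_1, ring_char_0}"
  shows "det (mat n n (\<lambda>(i, j). pochhammer (a + of_nat i) j)) = (\<Prod>j<n. fact j)"
proof -
  define p where "p = newton_poly (\<lambda>l. - of_nat l :: 'a)"
  have "poly (p j) z = pochhammer z j" for j z
    by (simp add: p_def poly_newton_poly pochhammer_prod atLeast0LessThan)
  hence "det (mat n n (\<lambda>(i, j). pochhammer (a + of_nat i) j)) =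
      det (eval_mat n p (\<lambda>i. a + of_nat i))"
    by (simp add: eval_mat_def)
  also have "\<dots> = vandermonde n (\<lambda>i. a + of_nat i) * det (coeff_mat n p)"
    unfolding p_def by (intro det_eval_mat le_less_trans[OF degree_newton_poly])
  finally show ?thesis
    by (simp add: p_def det_coeff_mat_newton_poly vandermonde_arith_prog)
qed

text \<open>Up to normalization, \<open>bernstein_poly n\<close> is the Bernstein basis of degree \<open>n - 1\<close>.\<close>

definition bernstein_poly :: "nat \<Rightarrow> nat \<Rightarrow> 'a :: comm_ring_1 poly" where
  "bernstein_poly n j = monom 1 j * [:1, -1:] ^ (n - Suc j)"

lemma poly_bernstein_poly: "poly (bernstein_poly n j) x = x ^ j * (1 - x) ^ (n - Suc j)"
  by (simp add: bernstein_poly_def poly_monom)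

lemma degree_bernstein_poly_less:
  assumes "j < n"
  shows "degree (bernstein_poly n j :: 'a :: comm_ring_1 poly) < n"
proof -
  have "degree (bernstein_poly n j :: 'a poly) \<le>
      degree (monom 1 j :: 'a poly) + degree ([:1, -1 :: 'a:] ^ (n - Suc j))"
    unfolding bernstein_poly_def by (rule degree_mult_le)
  also have "\<dots> \<le> j + (n - Suc j)"
    using degree_power_le[of "[:1, -1 :: 'a:]" "n - Suc j"]
    by (intro add_mono degree_monom_le) simp
  finally show ?thesis using assms by simp
qed

lemma det_coeff_mat_bernstein_poly: "det (coeff_mat n (bernstein_poly n)) = 1"
  by (rule det_coeff_mat_lower_unitriangular)
     (simp_all add: bernstein_poly_def coeff_monom_mult flip: poly_0_coeff_0)

lemma det_scale_rows_cols:
  fixes A :: "nat \<Rightarrow> nat \<Rightarrow> 'a :: comm_ring_1"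
  shows "det (mat n n (\<lambda>(i, j). r i * s j * A i j)) =
    (\<Prod>i<n. r i) * (\<Prod>j<n. s j) * det (mat n n (\<lambda>(i, j). A i j))"
proof -
  have "(\<Prod>i = 0..<n. r i * s (p i) * A i (p i)) =
      (\<Prod>i<n. r i) * (\<Prod>j<n. s j) * (\<Prod>i = 0..<n. A i (p i))"
    if "p permutes {0..<n}" for p
    using prod.permute[OF that, of s] by (simp add: prod.distrib o_def atLeast0LessThan)
  thus ?thesis
    by (simp add: det_def sum_distrib_left mult_ac permutes_in_image)
qed

section \<open>Andreief's identity\<close>

lemma det_eq_sum_permutations:
  "det (mat n n (\<lambda>(i, j). A i j)) = (\<Sum>p | p permutes {..<n}. signof p * (\<Prod>i<n. A i (p i)))"
  by (auto simp: det_def atLeast0LessThan permutes_in_image intro!: sum.cong prod.cong)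

lemma sum_pairs_permutations_eq_det:
  fixes A :: "nat \<Rightarrow> nat \<Rightarrow> 'a :: comm_ring_1" and n :: nat
  defines "S \<equiv> {p. p permutes {..<n}}"
  shows "(\<Sum>p\<in>S. \<Sum>q\<in>S. signof p * signof q * (\<Prod>k<n. A (p k) (q k))) =
    of_nat (fact n) * det (mat n n (\<lambda>(i, j). A i j))"
proof -
  have "(\<Sum>q\<in>S. signof p * signof q * (\<Prod>k<n. A (p k) (q k))) = det (mat n n (\<lambda>(i, j). A i j))"
    if "p \<in> S" for p
  proof -
    have p: "p permutes {..<n}" using that by (simp add: S_def)
    have "(\<Sum>q\<in>S. signof p * signof q * (\<Prod>k<n. A (p k) (q k))) =
        (\<Sum>q\<in>S. signof p * signof (q \<circ> p) * (\<Prod>k<n. A (p k) (q (p k))))"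
      unfolding S_def by (subst sum_permutations_compose_right[OF p]) simp
    also have "\<dots> = (\<Sum>q\<in>S. signof q * (\<Prod>k<n. A k (q k)))"
    proof (rule sum.cong)
      fix q assume "q \<in> S"
      hence "sign (q \<circ> p) = sign q * sign p"
        using p by (intro sign_compose) (auto simp: S_def permutation_permutes)
      moreover have "(\<Prod>k<n. A (p k) (q (p k))) = (\<Prod>k<n. A k (q k))"
        using prod.permute[OF p, of "\<lambda>k. A k (q k)"] by (simp add: o_def)
      ultimately show "signof p * signof (q \<circ> p) * (\<Prod>k<n. A (p k) (q (p k))) =
          signof q * (\<Prod>k<n. A k (q k))"
        by (simp add: sign_def)
    qed simp
    finally show ?thesis by (simp add: det_eq_sum_permutations S_def)
  qed
  moreover have "card S = fact n" by (simp add: S_def card_permutations)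
  ultimately show ?thesis by simp
qed

theorem (in sigma_finite_measure) andreief:
  fixes f g :: "nat \<Rightarrow> 'a \<Rightarrow> 'b :: {real_normed_field, banach, second_countable_topology}"
  assumes integrable_fg: "\<And>i j. i < n \<Longrightarrow> j < n \<Longrightarrow> integrable M (\<lambda>x. f i x * g j x)"
  defines "F \<equiv> \<lambda>x. det (mat n n (\<lambda>(k, i). f i (x k))) * det (mat n n (\<lambda>(k, j). g j (x k)))"
  shows "integrable (PiM {..<n} (\<lambda>_. M)) F"
    and "(\<integral>x. F x \<partial>PiM {..<n} (\<lambda>_. M)) = fact n * det (mat n n (\<lambda>(i, j). \<integral>x. f i x * g j x \<partial>M))"
proof -
  interpret product: product_sigma_finite "\<lambda>_::nat. M" ..
  define S where "S = {p. p permutes {..<n}}"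
  define summand where "summand = (\<lambda>p q x. \<Prod>k<n. f (p k) (x k) * g (q k) (x k))"
  have F_eq: "F = (\<lambda>x. \<Sum>p\<in>S. \<Sum>q\<in>S. signof p * signof q * summand p q x)"
    unfolding F_def det_eq_sum_permutations summand_def S_def sum_product prod.distrib
    by (simp only: mult_ac)
  have permutes_less: "p k < n" if "p \<in> S" "k < n" for p k
    using that permutes_in_image[of p "{..<n}" k] by (simp add: S_def)
  have integrable_summand: "integrable (PiM {..<n} (\<lambda>_. M)) (summand p q)"
    if "p \<in> S" "q \<in> S" for p q
    unfolding summand_def using that by (intro product.product_integrable_prod integrable_fg)
      (auto simp: permutes_less)
  have integral_summand: "(\<integral>x. summand p q x \<partial>PiM {..<n} (\<lambda>_. M)) =
      (\<Prod>k<n. \<integral>x. f (p k) x * g (q k) x \<partial>M)"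
    if "p \<in> S" "q \<in> S" for p q
    unfolding summand_def using that by (intro product.product_integral_prod integrable_fg)
      (auto simp: permutes_less)
  show "integrable (PiM {..<n} (\<lambda>_. M)) F"
    unfolding F_eq
    by (intro Bochner_Integration.integrable_sum integrable_mult_right integrable_summand)
  have "(\<integral>x. F x \<partial>PiM {..<n} (\<lambda>_. M)) =
      (\<Sum>p\<in>S. \<Sum>q\<in>S. signof p * signof q * (\<Prod>k<n. \<integral>x. f (p k) x * g (q k) x \<partial>M))"
    unfolding F_eq
    by (simp add: Bochner_Integration.integral_sum integrable_summand integral_summand)
  also have "\<dots> = fact n * det (mat n n (\<lambda>(i, j). \<integral>x. f i x * g j x \<partial>M))"
    using sum_pairs_permutations_eq_det[where A = "\<lambda>i j. \<integral>x. f i x * g j x \<partial>M" and n = n]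
    by (simp add: S_def)
  finally show "(\<integral>x. F x \<partial>PiM {..<n} (\<lambda>_. M)) =
      fact n * det (mat n n (\<lambda>(i, j). \<integral>x. f i x * g j x \<partial>M))" .
qed

section \<open>Vandermonde integrals\<close>

definition finite_moments :: "(real \<Rightarrow> real) \<Rightarrow> bool" where
  "finite_moments w \<longleftrightarrow> (\<forall>k. integrable lborel (\<lambda>x. x ^ k * w x))"

definition vandermonde_integral :: "(real \<Rightarrow> real) \<Rightarrow> nat \<Rightarrow> real" where
  "vandermonde_integral w n = (\<integral>x. (vandermonde n x)\<^sup>2 * (\<Prod>k<n. w (x k)) \<partial>PiM {..<n} (\<lambda>_. lborel))"

lemma integrable_poly_weight_poly:
  assumes "finite_moments w"
  shows "integrable lborel (\<lambda>x. poly p x * (w x * poly q x))"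
proof -
  have "integrable lborel (\<lambda>x. poly (p * q) x * w x)"
    using assms unfolding poly_altdef sum_distrib_right mult.assoc finite_moments_def
    by (intro Bochner_Integration.integrable_sum integrable_mult_right) auto
  thus ?thesis by (simp add: mult_ac)
qed

lemma vandermonde_square_eq_det:
  assumes "\<And>j. j < n \<Longrightarrow> degree (p j) < n" "det (coeff_mat n p) = 1"
    and "\<And>j. j < n \<Longrightarrow> degree (q j) < n" "det (coeff_mat n q) = 1"
  shows "(vandermonde n x)\<^sup>2 * (\<Prod>k<n. w (x k)) =
    det (mat n n (\<lambda>(k, i). poly (p i) (x k))) * det (mat n n (\<lambda>(k, j). w (x k) * poly (q j) (x k)))"
proof -
  have "det (mat n n (\<lambda>(k, j). w (x k) * poly (q j) (x k))) =
      (\<Prod>k<n. w (x k)) * det (eval_mat n q x)"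
    using det_scale_rows_cols[of n "\<lambda>k. w (x k)" "\<lambda>_. 1"] by (simp add: eval_mat_def)
  also have "det (eval_mat n q x) = vandermonde n x"
    using det_eval_mat[of n q x] assms(3,4) by simp
  moreover have "det (mat n n (\<lambda>(k, i). poly (p i) (x k))) = vandermonde n x"
    using det_eval_mat[of n p x] assms(1,2) by (simp add: eval_mat_def)
  ultimately show ?thesis by (simp add: power2_eq_square)
qed

lemma integrable_vandermonde_square:
  assumes "finite_moments w"
  shows "integrable (PiM {..<n} (\<lambda>_. lborel)) (\<lambda>x. (vandermonde n x)\<^sup>2 * (\<Prod>k<n. w (x k)))"
proof -
  have "det (coeff_mat n (monom 1 :: nat \<Rightarrow> real poly)) = 1"
    by (rule det_coeff_mat_upper_unitriangular) (simp_all add: degree_monom_eq)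
  hence "(\<lambda>x. (vandermonde n x)\<^sup>2 * (\<Prod>k<n. w (x k))) =
      (\<lambda>x. det (mat n n (\<lambda>(k, i). poly (monom 1 i) (x k))) *
      det (mat n n (\<lambda>(k, j). w (x k) * poly (monom 1 j) (x k))))"
    by (intro ext vandermonde_square_eq_det) (simp_all add: degree_monom_eq)
  thus ?thesis
    using lborel.andreief(1)[OF integrable_poly_weight_poly[OF assms]] by simp
qed

theorem vandermonde_integral_eq_det:
  assumes "finite_moments w"
    and "\<And>j. j < n \<Longrightarrow> degree (p j) < n" "det (coeff_mat n p) = 1"
    and "\<And>j. j < n \<Longrightarrow> degree (q j) < n" "det (coeff_mat n q) = 1"
  shows "vandermonde_integral w n =
    fact n * det (mat n n (\<lambda>(i, j). \<integral>x. poly (p i) x * (w x * poly (q j) x) \<partial>lborel))"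
proof -
  have "vandermonde_integral w n = (\<integral>x. det (mat n n (\<lambda>(k, i). poly (p i) (x k))) *
      det (mat n n (\<lambda>(k, j). w (x k) * poly (q j) (x k))) \<partial>PiM {..<n} (\<lambda>_. lborel))"
    unfolding vandermonde_integral_def
    by (intro Bochner_Integration.integral_cong refl vandermonde_square_eq_det assms(2-5))
  also have "\<dots> =
      fact n * det (mat n n (\<lambda>(i, j). \<integral>x. poly (p i) x * (w x * poly (q j) x) \<partial>lborel))"
    by (rule lborel.andreief(2)) (rule integrable_poly_weight_poly[OF assms(1)])
  finally show ?thesis .
qed

lemma vandermonde_integral_mono:
  assumes "finite_moments w" and "\<And>x. 0 \<le> v x" and "\<And>x. v x \<le> w x"
  shows "vandermonde_integral v n \<le> vandermonde_integral w n"
  unfolding vandermonde_integral_def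
proof (rule integral_mono'[OF integrable_vandermonde_square[OF assms(1)]])
  fix x :: "nat \<Rightarrow> real"
  have "0 \<le> w y" for y using assms(2,3) by (rule order.trans)
  thus "0 \<le> (vandermonde n x)\<^sup>2 * (\<Prod>k<n. w (x k))"
    by (intro mult_nonneg_nonneg prod_nonneg) auto
  show "(vandermonde n x)\<^sup>2 * (\<Prod>k<n. v (x k)) \<le> (vandermonde n x)\<^sup>2 * (\<Prod>k<n. w (x k))"
    using assms by (intro mult_left_mono prod_mono) auto
qed

lemma vandermonde_integral_mult:
  "vandermonde_integral (\<lambda>x. c * w x) n = c ^ n * vandermonde_integral w n"
proof -
  have "vandermonde_integral (\<lambda>x. c * w x) n =
      (\<integral>x. c ^ n * ((vandermonde n x)\<^sup>2 * (\<Prod>k<n. w (x k))) \<partial>PiM {..<n} (\<lambda>_. lborel))"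
    by (simp add: vandermonde_integral_def prod.distrib mult_ac)
  thus ?thesis by (simp add: vandermonde_integral_def)
qed

lemma vandermonde_integral_scale_moments:
  assumes "finite_moments v" "finite_moments w"
    and "\<And>k. (\<integral>x. (x - a) ^ k * w x \<partial>lborel) = b * c ^ k * (\<integral>x. (x - a) ^ k * v x \<partial>lborel)"
  shows "vandermonde_integral w n = b ^ n * c ^ (n * (n - 1)) * vandermonde_integral v n"
proof -
  define p where "p = (\<lambda>j. [:- a, 1:] ^ j)"
  have det_p: "det (coeff_mat n p) = 1"
    by (intro det_coeff_mat_upper_unitriangular) (simp_all add: p_def degree_linear_power coeff_linear_power)
  have hankel: "vandermonde_integral u n =
      fact n * det (mat n n (\<lambda>(i, j). \<integral>x. (x - a) ^ (i + j) * u x \<partial>lborel))"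
    if "finite_moments u" for u
    using vandermonde_integral_eq_det[OF that _ det_p _ det_p]
    by (simp add: p_def degree_linear_power power_add mult_ac)
  have "det (mat n n (\<lambda>(i, j). \<integral>x. (x - a) ^ (i + j) * w x \<partial>lborel)) =
      det (mat n n (\<lambda>(i, j). c ^ i * (b * c ^ j) * (\<integral>x. (x - a) ^ (i + j) * v x \<partial>lborel)))"
    unfolding assms(3) power_add[of c] by (simp only: mult_ac)
  also have "\<dots> = (\<Prod>i<n. c ^ i) * (\<Prod>j<n. b * c ^ j) *
      det (mat n n (\<lambda>(i, j). \<integral>x. (x - a) ^ (i + j) * v x \<partial>lborel))"
    by (rule det_scale_rows_cols)
  also have "(\<Prod>i<n. c ^ i) * (\<Prod>j<n. b * c ^ j) = b ^ n * c ^ (n * (n - 1))"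
  proof (induction n)
    case (Suc n)
    have "Suc n * (Suc n - 1) = n * (n - 1) + n + n" by (cases n) simp_all
    thus ?case using Suc.IH by (simp add: power_add mult_ac)
  qed simp
  finally show ?thesis by (simp add: hankel assms(1,2))
qed

section \<open>The Jacobi ensemble\<close>

definition jacobi_weight :: "real \<Rightarrow> real \<Rightarrow> real \<Rightarrow> real \<Rightarrow> real" where
  "jacobi_weight \<alpha> \<beta> t x = indicator {t..1} x * (x powr \<alpha> * (1 - x) powr \<beta>)"

lemma jacobi_weight_nonneg: "jacobi_weight \<alpha> \<beta> t x \<ge> 0"
  by (simp add: jacobi_weight_def)

lemma borel_measurable_jacobi_weight [measurable]: "jacobi_weight \<alpha> \<beta> t \<in> borel_measurable borel"
  unfolding jacobi_weight_def by measurable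

lemma power_mult_jacobi_weight:
  assumes "t \<ge> 0"
  shows "x ^ i * (1 - x) ^ j * jacobi_weight \<alpha> \<beta> t x = jacobi_weight (\<alpha> + real i) (\<beta> + real j) t x"
proof -
  have "u ^ k * u powr a = u powr (a + real k)" if "u \<ge> 0" for u a :: real and k
    using that by (cases "u = 0") (simp_all add: powr_add powr_realpow)
  from this[of x i \<alpha>] this[of "1 - x" j \<beta>]
  have "(x ^ i * x powr \<alpha>) * ((1 - x) ^ j * (1 - x) powr \<beta>) =
      x powr (\<alpha> + real i) * (1 - x) powr (\<beta> + real j)"
    if "x \<in> {t..1}"
    using that assms by simp
  thus ?thesis
    by (cases "x \<in> {t..1}") (simp_all add: jacobi_weight_def mult_ac)
qed

lemma has_bochner_integral_jacobi_weight:
  assumes "\<alpha> > -1" "\<beta> > -1"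
  shows "has_bochner_integral lborel (jacobi_weight \<alpha> \<beta> 0) (Beta (\<alpha> + 1) (\<beta> + 1))"
proof (rule has_bochner_integral_nn_integral)
  have "((\<lambda>x. x powr \<alpha> * (1 - x) powr \<beta>) has_integral Beta (\<alpha> + 1) (\<beta> + 1)) {0..1}"
    using has_integral_Beta_real[of "\<alpha> + 1" "\<beta> + 1"] assms by simp
  moreover have "jacobi_weight \<alpha> \<beta> 0 = (\<lambda>x. if x \<in> {0..1} then x powr \<alpha> * (1 - x) powr \<beta> else 0)"
    by (auto simp: jacobi_weight_def)
  ultimately have "(jacobi_weight \<alpha> \<beta> 0 has_integral Beta (\<alpha> + 1) (\<beta> + 1)) UNIV"
    by (simp only: has_integral_restrict_UNIV)
  thus "(\<integral>\<^sup>+x. jacobi_weight \<alpha> \<beta> 0 x \<partial>lborel) = ennreal (Beta (\<alpha> + 1) (\<beta> + 1))"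
    by (intro nn_integral_has_integral_lborel jacobi_weight_nonneg) measurable
  show "0 \<le> Beta (\<alpha> + 1) (\<beta> + 1)"
    using assms
    by (auto simp: Beta_def
        intro!: divide_nonneg_pos mult_nonneg_nonneg less_imp_le[OF Gamma_real_pos])
qed (auto simp: jacobi_weight_nonneg)

lemma finite_moments_jacobi_weight:
  assumes "\<alpha> > -1" "\<beta> > -1" "t \<ge> 0"
  shows "finite_moments (jacobi_weight \<alpha> \<beta> t)"
  unfolding finite_moments_def
proof
  fix k
  have "integrable lborel (jacobi_weight (\<alpha> + real k) \<beta> 0)"
    using has_bochner_integral_jacobi_weight[of "\<alpha> + real k" \<beta>] assms
    by (auto simp: has_bochner_integral_iff)
  thus "integrable lborel (\<lambda>x. x ^ k * jacobi_weight \<alpha> \<beta> t x)"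
  proof (rule Bochner_Integration.integrable_bound)
    show "AE x in lborel. norm (x ^ k * jacobi_weight \<alpha> \<beta> t x) \<le>
        norm (jacobi_weight (\<alpha> + real k) \<beta> 0 x)"
    proof (rule AE_I2)
      fix x :: real
      have "x ^ k * jacobi_weight \<alpha> \<beta> t x = jacobi_weight (\<alpha> + real k) \<beta> t x"
        using power_mult_jacobi_weight[OF assms(3), of x k 0] by simp
      moreover have "jacobi_weight (\<alpha> + real k) \<beta> t x \<le> jacobi_weight (\<alpha> + real k) \<beta> 0 x"
        using assms(3) by (auto simp: jacobi_weight_def indicator_def)
      ultimately show "norm (x ^ k * jacobi_weight \<alpha> \<beta> t x) \<le>
          norm (jacobi_weight (\<alpha> + real k) \<beta> 0 x)"
        by (simp add: jacobi_weight_nonneg)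
    qed
  qed measurable
qed

lemma Dn_conv_vandermonde_integral:
  "Dn \<alpha> \<beta> n t = vandermonde_integral (jacobi_weight \<alpha> \<beta> t) n / fact n"
proof -
  have "indicator {x. \<forall>i<n. x i \<in> {t..1}} x =
      (\<Prod>k<n. indicator {t..1} (x k) :: real)" for x :: "nat \<Rightarrow> real"
    by (auto simp: indicator_def intro!: prod_zero[symmetric])
  thus ?thesis
    unfolding Dn_def vandermonde_integral_def vandermonde_def jacobi_weight_def
    by (simp add: prod.distrib prod_power_distrib mult_ac)
qed

definition selberg_prod :: "real \<Rightarrow> real \<Rightarrow> nat \<Rightarrow> real" where
  "selberg_prod \<alpha> \<beta> n = (\<Prod>j<n. fact j * Gamma (\<alpha> + 1 + real j) * Gamma (\<beta> + 1 + real j) /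
     Gamma (\<alpha> + \<beta> + 1 + real n + real j))"

lemma selberg_prod_pos:
  assumes "\<alpha> > -1" "\<beta> > -1"
  shows "selberg_prod \<alpha> \<beta> n > 0"
  unfolding selberg_prod_def
  by (intro prod_pos ballI mult_pos_pos divide_pos_pos Gamma_real_pos) (use assms in auto)

lemma Gamma_add_of_nat:
  assumes "z \<notin> \<int>\<^sub>\<le>\<^sub>0"
  shows "Gamma (z + of_nat n) = Gamma z * pochhammer z n"
  using assms by (simp add: pochhammer_Gamma Gamma_eq_zero_iff)

lemma integral_power_mult_jacobi_weight:
  assumes "\<alpha> > -1" "\<beta> > -1"
  shows "(\<integral>x. x ^ i * (1 - x) ^ j * jacobi_weight \<alpha> \<beta> 0 x \<partial>lborel) =
    Beta (\<alpha> + 1 + real i) (\<beta> + 1 + real j)"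
  using has_bochner_integral_jacobi_weight[of "\<alpha> + real i" "\<beta> + real j"] assms
  by (simp add: power_mult_jacobi_weight has_bochner_integral_iff add_ac)

lemma integral_monom_jacobi_weight_bernstein_poly:
  assumes "\<alpha> > -1" "\<beta> > -1" "j < n"
  shows "(\<integral>x. poly (monom 1 i) x * (jacobi_weight \<alpha> \<beta> 0 x * poly (bernstein_poly n j) x) \<partial>lborel) =
    Gamma (\<alpha> + 1 + real i) / Gamma (\<alpha> + \<beta> + 1 + real n + real i) *
    Gamma (\<beta> + 1 + real (n - Suc j)) * pochhammer (\<alpha> + 1 + real i) j"
proof -
  have "(\<integral>x. poly (monom 1 i) x * (jacobi_weight \<alpha> \<beta> 0 x * poly (bernstein_poly n j) x) \<partial>lborel) =
      (\<integral>x. x ^ (i + j) * (1 - x) ^ (n - Suc j) * jacobi_weight \<alpha> \<beta> 0 x \<partial>lborel)"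
    by (simp add: poly_bernstein_poly poly_monom power_add mult_ac)
  also have "\<dots> = Beta (\<alpha> + 1 + real (i + j)) (\<beta> + 1 + real (n - Suc j))"
    by (rule integral_power_mult_jacobi_weight[OF assms(1,2)])
  also have "\<dots> = Gamma (\<alpha> + 1 + real i + real j) * Gamma (\<beta> + 1 + real (n - Suc j)) /
      Gamma (\<alpha> + \<beta> + 1 + real n + real i)"
    using assms(3) by (simp add: Beta_def of_nat_diff algebra_simps)
  also have "Gamma (\<alpha> + 1 + real i + real j) =
      Gamma (\<alpha> + 1 + real i) * pochhammer (\<alpha> + 1 + real i) j"
    using assms(1) by (intro Gamma_add_of_nat) (auto dest!: nonpos_Ints_nonpos)
  finally show ?thesis by simp
qed

theorem Dn_0_eq_selberg_prod:
  assumes "\<alpha> > -1" "\<beta> > -1"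
  shows "Dn \<alpha> \<beta> n 0 = selberg_prod \<alpha> \<beta> n"
proof -
  define r where "r = (\<lambda>i. Gamma (\<alpha> + 1 + real i) / Gamma (\<alpha> + \<beta> + 1 + real n + real i))"
  define s where "s = (\<lambda>j. Gamma (\<beta> + 1 + real (n - Suc j)))"
  have det_monom: "det (coeff_mat n (monom 1 :: nat \<Rightarrow> real poly)) = 1"
    by (rule det_coeff_mat_upper_unitriangular) (simp_all add: degree_monom_eq)
  have "vandermonde_integral (jacobi_weight \<alpha> \<beta> 0) n = fact n * det (mat n n (\<lambda>(i, j).
      \<integral>x. poly (monom 1 i) x * (jacobi_weight \<alpha> \<beta> 0 x * poly (bernstein_poly n j) x) \<partial>lborel))"
    using assms
    by (intro vandermonde_integral_eq_det finite_moments_jacobi_weight det_monom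
        degree_bernstein_poly_less det_coeff_mat_bernstein_poly) (auto simp: degree_monom_eq)
  also have "mat n n (\<lambda>(i, j).
      \<integral>x. poly (monom 1 i) x * (jacobi_weight \<alpha> \<beta> 0 x * poly (bernstein_poly n j) x) \<partial>lborel) =
      mat n n (\<lambda>(i, j). r i * s j * pochhammer (\<alpha> + 1 + real i) j)"
    using integral_monom_jacobi_weight_bernstein_poly[OF assms]
    by (intro cong_mat) (simp_all add: r_def s_def)
  also have "det \<dots> = (\<Prod>i<n. r i) * (\<Prod>j<n. s j) * (\<Prod>j<n. fact j)"
    unfolding det_scale_rows_cols det_pochhammer ..
  also have "(\<Prod>j<n. s j) = (\<Prod>j<n. Gamma (\<beta> + 1 + real j))"
    unfolding s_def by (rule prod.nat_diff_reindex)
  finally show ?thesis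
    by (simp add: Dn_conv_vandermonde_integral selberg_prod_def r_def prod.distrib prod_dividef
        mult_ac)
qed

text \<open>The point \<open>y = 0\<close> is exceptional only because \<^prop>\<open>0 powr 0 = (0 :: real)\<close>.\<close>

lemma jacobi_weight_0_affine:
  assumes "0 \<le> t" "t < 1" "y \<noteq> 0"
  shows "jacobi_weight 0 \<beta> t (t + (1 - t) * y) = (1 - t) powr \<beta> * jacobi_weight 0 \<beta> 0 y"
proof -
  have in_interval: "t + (1 - t) * y \<in> {t..1} \<longleftrightarrow> y \<in> {0..1}"
  proof -
    have "1 - (t + (1 - t) * y) = (1 - t) * (1 - y)" by (simp add: algebra_simps)
    hence "t + (1 - t) * y \<le> 1 \<longleftrightarrow> 0 \<le> (1 - t) * (1 - y)" by linarith
    thus ?thesis using assms(2) by (simp add: zero_le_mult_iff)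
  qed
  show ?thesis
  proof (cases "y \<in> {0..1}")
    case True
    have "(1 - t) * y > 0" using True assms by simp
    hence "(t + (1 - t) * y) powr 0 = 1" using assms(1) by simp
    moreover have "(1 - (t + (1 - t) * y)) powr \<beta> = (1 - t) powr \<beta> * (1 - y) powr \<beta>"
      using True assms(2) by (subst powr_mult[symmetric]) (simp_all add: algebra_simps)
    ultimately show ?thesis using True assms(3) in_interval by (simp add: jacobi_weight_def)
  qed (use in_interval in \<open>simp add: jacobi_weight_def\<close>)
qed

lemma integral_jacobi_weight_0_scale:
  assumes "0 \<le> t" "t < 1"
  shows "(\<integral>x. (x - 1) ^ k * jacobi_weight 0 \<beta> t x \<partial>lborel) =
    (1 - t) powr (\<beta> + 1) * (1 - t) ^ k * (\<integral>x. (x - 1) ^ k * jacobi_weight 0 \<beta> 0 x \<partial>lborel)"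
proof -
  define c where "c = 1 - t"
  have c_pos: "c > 0" using assms by (simp add: c_def)
  have "(\<integral>x. (x - 1) ^ k * jacobi_weight 0 \<beta> t x \<partial>lborel) =
      c * (\<integral>y. (t + c * y - 1) ^ k * jacobi_weight 0 \<beta> t (t + c * y) \<partial>lborel)"
    using lborel_integral_real_affine[of c "\<lambda>x. (x - 1) ^ k * jacobi_weight 0 \<beta> t x" t] c_pos
    by simp
  also have "(\<integral>y. (t + c * y - 1) ^ k * jacobi_weight 0 \<beta> t (t + c * y) \<partial>lborel) =
      (\<integral>y. c powr \<beta> * c ^ k * ((y - 1) ^ k * jacobi_weight 0 \<beta> 0 y) \<partial>lborel)"
  proof (rule integral_cong_AE)
    have "(t + c * y - 1) ^ k * jacobi_weight 0 \<beta> t (t + c * y) =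
        c powr \<beta> * c ^ k * ((y - 1) ^ k * jacobi_weight 0 \<beta> 0 y)" if "y \<noteq> 0" for y
    proof -
      have "t + c * y - 1 = c * (y - 1)" by (simp add: c_def algebra_simps)
      thus ?thesis using jacobi_weight_0_affine[OF assms that, of \<beta>]
        by (simp add: c_def power_mult_distrib)
    qed
    thus "AE y in lborel. (t + c * y - 1) ^ k * jacobi_weight 0 \<beta> t (t + c * y) =
        c powr \<beta> * c ^ k * ((y - 1) ^ k * jacobi_weight 0 \<beta> 0 y)"
      using AE_lborel_singleton[of 0] by (auto elim: eventually_mono)
  qed measurable
  finally show ?thesis using c_pos by (simp add: powr_add flip: c_def)
qed

lemma Dn_alpha_0_scaling:
  assumes "\<beta> > -1" "0 \<le> t" "t < 1"
  shows "Dn 0 \<beta> n t = (1 - t) powr (real n * (real n + \<beta>)) * Dn 0 \<beta> n 0"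
proof -
  have "vandermonde_integral (jacobi_weight 0 \<beta> t) n =
      ((1 - t) powr (\<beta> + 1)) ^ n * (1 - t) ^ (n * (n - 1)) *
      vandermonde_integral (jacobi_weight 0 \<beta> 0) n"
    using assms
    by (intro vandermonde_integral_scale_moments[where a = 1] finite_moments_jacobi_weight
        integral_jacobi_weight_0_scale) auto
  also have "((1 - t) powr (\<beta> + 1)) ^ n * (1 - t) ^ (n * (n - 1)) =
      (1 - t) powr (real n * (\<beta> + 1) + real (n * (n - 1)))"
    using assms(3)
    by (simp add: powr_add[of _ "real n * (\<beta> + 1)"] powr_realpow powr_power mult.commute
        del: of_nat_mult)
  also have "real n * (\<beta> + 1) + real (n * (n - 1)) = real n * (real n + \<beta>)"
    by (cases n) (simp_all add: algebra_simps)
  finally show ?thesis by (simp add: Dn_conv_vandermonde_integral)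
qed

lemma jacobi_weight_bounds:
  assumes "\<alpha> \<ge> 0" "0 < t"
  shows "t powr \<alpha> * jacobi_weight 0 \<beta> t x \<le> jacobi_weight \<alpha> \<beta> t x"
    and "jacobi_weight \<alpha> \<beta> t x \<le> jacobi_weight 0 \<beta> t x"
proof -
  have "t powr \<alpha> \<le> x powr \<alpha> \<and> x powr \<alpha> \<le> 1" if "x \<in> {t..1}"
    using that assms by (auto intro: powr_mono2 powr_le1)
  thus "t powr \<alpha> * jacobi_weight 0 \<beta> t x \<le> jacobi_weight \<alpha> \<beta> t x"
    and "jacobi_weight \<alpha> \<beta> t x \<le> jacobi_weight 0 \<beta> t x"
    using assms(2)
    by (auto simp: jacobi_weight_def indicator_def
        intro!: mult_right_mono mult_left_le_one_le)
qed

lemma Dn_quotient_bounds: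
  assumes "\<alpha> \<ge> 0" "\<beta> > -1" "0 < t" "t < 1"
  shows "Dn \<alpha> \<beta> n t / Dn 0 \<beta> n t \<in> {t powr (real n * \<alpha>)..1}"
proof -
  have "vandermonde_integral (\<lambda>x. t powr \<alpha> * jacobi_weight 0 \<beta> t x) n \<le>
      vandermonde_integral (jacobi_weight \<alpha> \<beta> t) n"
    using assms
    by (intro vandermonde_integral_mono finite_moments_jacobi_weight jacobi_weight_bounds)
       (auto simp: jacobi_weight_nonneg)
  hence "t powr (real n * \<alpha>) * Dn 0 \<beta> n t \<le> Dn \<alpha> \<beta> n t"
    using assms(3)
    by (simp add: vandermonde_integral_mult Dn_conv_vandermonde_integral divide_right_mono
        powr_power mult.commute)
  moreover have "vandermonde_integral (jacobi_weight \<alpha> \<beta> t) n \<le>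
      vandermonde_integral (jacobi_weight 0 \<beta> t) n"
    using assms
    by (intro vandermonde_integral_mono finite_moments_jacobi_weight jacobi_weight_bounds)
       (auto simp: jacobi_weight_nonneg)
  hence "Dn \<alpha> \<beta> n t \<le> Dn 0 \<beta> n t"
    by (simp add: Dn_conv_vandermonde_integral divide_right_mono)
  moreover have "Dn 0 \<beta> n t > 0"
    using assms by (simp add: Dn_alpha_0_scaling Dn_0_eq_selberg_prod selberg_prod_pos)
  ultimately show ?thesis
    by (simp add: pos_le_divide_eq pos_divide_le_eq)
qed

lemma Dn_quotient_tendsto_1:
  assumes "\<alpha> \<ge> 0" "\<beta> > -1"
  shows "((\<lambda>t. Dn \<alpha> \<beta> n t / Dn 0 \<beta> n t) \<longlongrightarrow> 1) (at_left 1)"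
proof (rule tendsto_sandwich)
  have "\<forall>\<^sub>F t in at_left 1. t \<in> {0<..<1 :: real}"
    by (rule eventually_at_left_real) simp
  hence bounds: "\<forall>\<^sub>F t in at_left 1. Dn \<alpha> \<beta> n t / Dn 0 \<beta> n t \<in> {t powr (real n * \<alpha>)..1}"
    by eventually_elim (use assms Dn_quotient_bounds in auto)
  show "\<forall>\<^sub>F t in at_left 1. t powr (real n * \<alpha>) \<le> Dn \<alpha> \<beta> n t / Dn 0 \<beta> n t"
    and "\<forall>\<^sub>F t in at_left 1. Dn \<alpha> \<beta> n t / Dn 0 \<beta> n t \<le> 1"
    using bounds by (auto elim: eventually_mono)
  show "((\<lambda>t. t powr (real n * \<alpha>)) \<longlongrightarrow> 1) (at_left (1 :: real))"
    by (rule tendsto_eq_intros refl | simp)+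
qed simp

section \<open>The asymptotic constant\<close>

lemma Gamma_legendre_duplication_real:
  fixes z :: real
  assumes "z \<notin> \<int>\<^sub>\<le>\<^sub>0" "z + 1 / 2 \<notin> \<int>\<^sub>\<le>\<^sub>0"
  shows "Gamma z * Gamma (z + 1 / 2) = 2 powr (1 - 2 * z) * sqrt pi * Gamma (2 * z)"
proof -
  have "complex_of_real z \<notin> \<int>\<^sub>\<le>\<^sub>0" "complex_of_real z + 1 / 2 \<notin> \<int>\<^sub>\<le>\<^sub>0"
    using assms of_real_in_nonpos_Ints_iff[of "z + 1 / 2", where 'a = complex]
    by (simp_all add: of_real_in_nonpos_Ints_iff)
  from Gamma_legendre_duplication[OF this]
  have "complex_of_real (Gamma z * Gamma (z + 1 / 2)) =
      complex_of_real (exp ((1 - 2 * z) * ln 2) * sqrt pi * Gamma (2 * z))"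
    unfolding of_real_mult Gamma_complex_of_real[symmetric] exp_of_real[symmetric] by simp
  thus ?thesis unfolding of_real_eq_iff powr_def by simp
qed

lemma Gamma_mult_Gamma_half_square:
  fixes z :: real
  assumes "z > 0"
  shows "z * (Gamma z * Gamma (z + 1 / 2))\<^sup>2 =
    Gamma (2 * z) * Gamma (2 * z + 1) / (2 powr (4 * z) / (2 * pi))"
proof -
  have "Gamma z * Gamma (z + 1 / 2) = 2 powr (1 - 2 * z) * sqrt pi * Gamma (2 * z)"
    using assms by (intro Gamma_legendre_duplication_real) (auto dest!: nonpos_Ints_nonpos)
  hence "(Gamma z * Gamma (z + 1 / 2))\<^sup>2 = (2 powr (1 - 2 * z))\<^sup>2 * pi * (Gamma (2 * z))\<^sup>2"
    by (simp add: power_mult_distrib)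
  also have "(2 powr (1 - 2 * z))\<^sup>2 = 4 / 2 powr (4 * z)"
    by (simp add: powr_diff power_divide powr_power)
  moreover have "Gamma (2 * z + 1) = 2 * z * Gamma (2 * z)"
    using assms by (intro Gamma_plus1) (auto dest!: nonpos_Ints_nonpos)
  ultimately show ?thesis by (simp add: power2_eq_square)
qed

lemma prod_even_odd_eq_prod_halves:
  fixes f :: "nat \<Rightarrow> 'a :: comm_monoid_mult"
  shows "(\<Prod>j<n. f (2 * j) * f (2 * j + 1)) = (\<Prod>j<n. f j) * (\<Prod>j<n. f (n + j))"
proof -
  have "(\<Prod>j<n. f (2 * j) * f (2 * j + 1)) = (\<Prod>k<2 * n. f k)"
    by (induction n) (simp_all add: mult.assoc)
  also have "\<dots> = (\<Prod>j<n. f j) * (\<Prod>j<n. f (n + j))"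
  proof -
    have "(\<Prod>k<n + m. f k) = (\<Prod>j<n. f j) * (\<Prod>j<m. f (n + j))" for m
      by (induction m) (simp_all add: mult.assoc)
    thus ?thesis by (simp add: mult_2)
  qed
  finally show ?thesis .
qed

lemma Ffun_mult_Kfun_eq_prod_Gamma:
  assumes "\<alpha> > -1" "\<beta> > -1" "\<alpha> + \<beta> + 1 > 0"
  defines "z \<equiv> \<lambda>j. (\<alpha> + \<beta> + 1) / 2 + real j"
  shows "Ffun \<alpha> \<beta> * Kfun \<alpha> \<beta> n =
    (\<Prod>j<n. fact j * Gamma (\<alpha> + 1 + real j) * Gamma (\<beta> + 1 + real j) * Gamma (\<alpha> + \<beta> + 1 + real j) /
      (z j * (Gamma (z j) * Gamma (z j + 1 / 2))\<^sup>2))"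
proof -
  define s where "s = \<alpha> + \<beta> + 1"
  have "s > 0" using assms by (simp add: s_def)
  hence pos: "1 > (0 :: real)" "\<alpha> + 1 > 0" "\<beta> + 1 > 0" "s > 0" "s / 2 > 0" "s / 2 + 1 / 2 > 0"
    using assms by simp_all
  have factors_pos: "barnesG (\<alpha> + 1) > 0" "barnesG (\<beta> + 1) > 0" "barnesG s > 0"
    "barnesG (s / 2) > 0" "barnesG (s / 2 + 1 / 2) > 0" "Gamma (s / 2) > 0"
    using pos by (auto intro: barnesG_pos)
  have Ffun_eq: "Ffun \<alpha> \<beta> = Gamma (s / 2) * (barnesG (s / 2))\<^sup>2 * (barnesG (s / 2 + 1 / 2))\<^sup>2 /
      (barnesG s * barnesG (\<alpha> + 1) * barnesG (\<beta> + 1))"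
    by (simp add: Ffun_def s_def add_divide_distrib add_ac)
  have Kfun_eq: "Kfun \<alpha> \<beta> n =
      barnesG (1 + real n) * barnesG (\<alpha> + 1 + real n) * barnesG (\<beta> + 1 + real n) *
      barnesG (s + real n) / ((barnesG (s / 2 + real n))\<^sup>2 * (barnesG (s / 2 + 1 / 2 + real n))\<^sup>2 *
      Gamma (s / 2 + real n))"
    by (simp add: Kfun_def s_def add_divide_distrib add_ac)
  have "s / 2 \<notin> \<int>\<^sub>\<le>\<^sub>0" using pos by (auto dest!: nonpos_Ints_nonpos)
  hence Gamma_shift: "Gamma (s / 2 + real n) = Gamma (s / 2) * (\<Prod>j<n. s / 2 + real j)"
    by (simp add: Gamma_add_of_nat pochhammer_prod atLeast0LessThan)
  have "Gamma (1 + real j) = fact j" for j by (rule Gamma_fact)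
  hence "Ffun \<alpha> \<beta> * Kfun \<alpha> \<beta> n =
      (\<Prod>j<n. fact j) * (\<Prod>j<n. Gamma (\<alpha> + 1 + real j)) *
      (\<Prod>j<n. Gamma (\<beta> + 1 + real j)) * (\<Prod>j<n. Gamma (s + real j)) /
      ((\<Prod>j<n. Gamma (s / 2 + real j))\<^sup>2 * (\<Prod>j<n. Gamma (s / 2 + 1 / 2 + real j))\<^sup>2 *
      (\<Prod>j<n. s / 2 + real j))"
    unfolding Ffun_eq Kfun_eq Gamma_shift pos[THEN barnesG_add_of_nat]
    using factors_pos by (simp add: power_mult_distrib)
  thus ?thesis
    by (simp add: z_def s_def prod.distrib prod_dividef
        prod_power_distrib power_mult_distrib mult_ac add_ac)
qed

theorem Ffun_mult_Kfun_eq_selberg_prod: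
  assumes "\<alpha> > -1" "\<beta> > -1" "\<alpha> + \<beta> + 1 > 0"
  shows "Ffun \<alpha> \<beta> * Kfun \<alpha> \<beta> n =
    selberg_prod \<alpha> \<beta> n * (\<Prod>j<n. 2 powr (2 * (\<alpha> + \<beta> + 1) + 4 * real j) / (2 * pi))"
proof -
  define s where "s = \<alpha> + \<beta> + 1"
  define numerator where "numerator = (\<lambda>j. fact j * Gamma (\<alpha> + 1 + real j) * Gamma (\<beta> + 1 + real j))"
  define power_factor where "power_factor = (\<lambda>j. 2 powr (2 * s + 4 * real j) / (2 * pi))"
  have s_pos: "s > 0" using assms by (simp add: s_def)
  have denominator_eq:
    "(s / 2 + real j) * (Gamma (s / 2 + real j) * Gamma (s / 2 + real j + 1 / 2))\<^sup>2 =
      Gamma (s + 2 * real j) * Gamma (s + 2 * real j + 1) / power_factor j" for j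
    using Gamma_mult_Gamma_half_square[of "s / 2 + real j"] s_pos
    by (simp add: power_factor_def distrib_left)
  have prod_Gamma: "(\<Prod>j<n. Gamma (s + 2 * real j) * Gamma (s + 2 * real j + 1)) =
      (\<Prod>j<n. Gamma (s + real j)) * (\<Prod>j<n. Gamma (s + real n + real j))"
    using prod_even_odd_eq_prod_halves[of "\<lambda>j. Gamma (s + real j)" n] by (simp add: add_ac)
  have "Ffun \<alpha> \<beta> * Kfun \<alpha> \<beta> n =
      (\<Prod>j<n. numerator j * Gamma (s + real j) /
        (Gamma (s + 2 * real j) * Gamma (s + 2 * real j + 1) / power_factor j))"
    using Ffun_mult_Kfun_eq_prod_Gamma[OF assms, of n]
    unfolding s_def[symmetric] denominator_eq numerator_def .
  also have "\<dots> =
      (\<Prod>j<n. numerator j) / (\<Prod>j<n. Gamma (s + real n + real j)) * (\<Prod>j<n. power_factor j)"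
  proof -
    have "Gamma (s + real j) \<noteq> 0" for j
      using s_pos by (intro less_imp_neq[symmetric] Gamma_real_pos) simp
    thus ?thesis using prod_Gamma by (simp add: prod.distrib prod_dividef)
  qed
  finally show ?thesis
    by (simp add: selberg_prod_def numerator_def power_factor_def s_def prod_dividef)
qed

lemma Ffun_Kfun_quotient:
  assumes "\<alpha> > -1" "\<beta> > -1" "\<alpha> + \<beta> + 1 > 0"
  shows "2 powr (2 * real n * \<alpha>) * (Ffun 0 \<beta> * Kfun 0 \<beta> n) / (Ffun \<alpha> \<beta> * Kfun \<alpha> \<beta> n) =
    selberg_prod 0 \<beta> n / selberg_prod \<alpha> \<beta> n"
proof -
  define power_prod where "power_prod = (\<lambda>\<alpha>. \<Prod>j<n. 2 powr (2 * (\<alpha> + \<beta> + 1) + 4 * real j) / (2 * pi))"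
  have "power_prod 0 > 0" unfolding power_prod_def by (intro prod_pos) auto
  have "power_prod \<alpha> = (\<Prod>j<n. 2 powr (2 * \<alpha>) * (2 powr (2 * (\<beta> + 1) + 4 * real j) / (2 * pi)))"
    unfolding power_prod_def by (intro prod.cong) (simp_all add: algebra_simps flip: powr_add)
  also have "\<dots> = 2 powr (2 * real n * \<alpha>) * power_prod 0"
    unfolding power_prod_def prod.distrib by (simp add: powr_power mult_ac)
  finally have "power_prod \<alpha> = 2 powr (2 * real n * \<alpha>) * power_prod 0" .
  moreover have "Ffun \<alpha> \<beta> * Kfun \<alpha> \<beta> n = selberg_prod \<alpha> \<beta> n * power_prod \<alpha>"
    unfolding power_prod_def using assms by (intro Ffun_mult_Kfun_eq_selberg_prod)
  moreover have "Ffun 0 \<beta> * Kfun 0 \<beta> n = selberg_prod 0 \<beta> n * power_prod 0"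
    unfolding power_prod_def using assms by (intro Ffun_mult_Kfun_eq_selberg_prod) auto
  ultimately show ?thesis using \<open>power_prod 0 > 0\<close> by simp
qed

theorem theorem1p2:
  fixes \<alpha> \<beta> :: real and n :: nat
  assumes "\<alpha> > 0" and "\<beta> > 0" and "n \<ge> 1"
  shows "((\<lambda>t. (Dn \<alpha> \<beta> n t / Dn \<alpha> \<beta> n 0) /
            (2 powr (2 * real n * \<alpha>) * (Ffun 0 \<beta> * Kfun 0 \<beta> n) / (Ffun \<alpha> \<beta> * Kfun \<alpha> \<beta> n)
             * (1 - t) powr (real n * (real n + \<beta>))))
         \<longlongrightarrow> 1) (at_left 1)"
proof (rule Lim_transform_eventually)
  show "((\<lambda>t. Dn \<alpha> \<beta> n t / Dn 0 \<beta> n t) \<longlongrightarrow> 1) (at_left 1)"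
    using assms by (intro Dn_quotient_tendsto_1) auto
  have constant_eq: "2 powr (2 * real n * \<alpha>) * (Ffun 0 \<beta> * Kfun 0 \<beta> n) / (Ffun \<alpha> \<beta> * Kfun \<alpha> \<beta> n) =
      Dn 0 \<beta> n 0 / Dn \<alpha> \<beta> n 0"
    using assms by (simp add: Ffun_Kfun_quotient Dn_0_eq_selberg_prod)
  have "Dn \<alpha> \<beta> n 0 > 0"
    using assms by (simp add: Dn_0_eq_selberg_prod selberg_prod_pos)
  hence quotient_eq: "Dn \<alpha> \<beta> n t / Dn 0 \<beta> n t = (Dn \<alpha> \<beta> n t / Dn \<alpha> \<beta> n 0) /
      (Dn 0 \<beta> n 0 / Dn \<alpha> \<beta> n 0 * (1 - t) powr (real n * (real n + \<beta>)))" if "t \<in> {0<..<1}" for t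
    using that assms by (simp add: Dn_alpha_0_scaling[of \<beta> t] mult.commute)
  have "\<forall>\<^sub>F t in at_left 1. t \<in> {0<..<1 :: real}"
    by (rule eventually_at_left_real) simp
  thus "\<forall>\<^sub>F t in at_left 1. Dn \<alpha> \<beta> n t / Dn 0 \<beta> n t = (Dn \<alpha> \<beta> n t / Dn \<alpha> \<beta> n 0) /
      (2 powr (2 * real n * \<alpha>) * (Ffun 0 \<beta> * Kfun 0 \<beta> n) / (Ffun \<alpha> \<beta> * Kfun \<alpha> \<beta> n)
        * (1 - t) powr (real n * (real n + \<beta>)))"
    unfolding constant_eq by eventually_elim (rule quotient_eq)
qed

end
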